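(* Let $N\in\mathbb{N}$. Assume that $F_3\in C^0[-1,1)$ is real-valued and that $|(1-x)^{3/2}F_3(x)|$ is bounded on $[-1,1)$. Then there exists $L_3=L_3(F_3,N)>0$ such that $$\left|\sum_{|k|\le n-1}\frac1nF_3\left(\frac kn\right)\right|\le L_3\,n^{1/2}\quad\text{for all integers } n\ge N,$$ where the sum is over all integers $k$ with $|k|\le n-1$.
   Context: $\mathbb{N}$ denotes the positive integers. $C^0[-1,1)$ denotes the continuous functions on the half-open interval $[-1,1)$. The notation $L_3(F_3,N)$ means that the constant may depend on $F_3$ and $N$, but not on $n$. *)

theory Defs
  imports "HOL-Analysis.Analysis"
begin

end

theory Submission
  imports Defs
begin

text \<open>The hypothesis says \<open>\<bar>F x\<bar> \<le> C (1 - x)\<^bsup>-3/2\<^esup>\<close>. At the node \<open>x = k/n\<close> we have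
  \<open>1 - x = j/n\<close>, where \<open>j = n - k\<close> is a positive integer, so the corresponding term of the Riemann
  sum is at most \<open>(1/n) C (j/n)\<^bsup>-3/2\<^esup> = C n\<^bsup>1/2\<^esup> j\<^bsup>-3/2\<^esup>\<close>. Distinct \<open>k\<close> give distinct \<open>j\<close>, and
  \<open>j\<^bsup>-3/2\<^esup>\<close> is summable over the positive integers because \<open>3/2 > 1\<close>; hence the whole sum is
  at most \<open>C \<zeta>(3/2) n\<^bsup>1/2\<^esup>\<close>. The factor \<open>n\<^bsup>1/2\<^esup>\<close> reflects the singularity at the endpoint
  \<open>1\<close>: in the majorant it is already reached by the single node \<open>j = 1\<close>.\<close>

theorem proposition3:
  fixes N :: nat and F\<^sub>3 :: "real \<Rightarrow> real"
  assumes "N \<ge> 1"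
    and "continuous_on {-1..<1} F\<^sub>3"
    and "bounded ((\<lambda>x. \<bar>(1 - x) powr (3/2) * F\<^sub>3 x\<bar>) ` {-1..<1})"
  shows "\<exists>L\<^sub>3::real. L\<^sub>3 > 0 \<and>
    (\<forall>n::nat. n \<ge> N \<longrightarrow>
      \<bar>\<Sum>k\<in>{k::int. \<bar>k\<bar> \<le> int n - 1}. 1 / real n * F\<^sub>3 (real_of_int k / real n)\<bar>
        \<le> L\<^sub>3 * real n powr (1/2))"
proof -
  obtain C where C: "C > 0" "\<And>x. x \<in> {-1..<1} \<Longrightarrow> \<bar>(1 - x) powr (3/2) * F\<^sub>3 x\<bar> \<le> C"
    using assms(3) unfolding bounded_pos by auto
  \<comment> \<open>\<open>0 powr _ = 0\<close>, so the index \<open>j = 0\<close> adds nothing to the sum of \<open>g\<close>, which is \<open>\<zeta>(3/2)\<close>.\<close>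
  define g where "g = (\<lambda>j::nat. real j powr (-3/2))"
  have g: "summable g"
    unfolding g_def by (simp add: summable_real_powr_iff)
  have g_nonneg: "g j \<ge> 0" for j
    by (simp add: g_def)
  have "\<bar>\<Sum>k\<in>{k::int. \<bar>k\<bar> \<le> int n - 1}. 1 / real n * F\<^sub>3 (real_of_int k / real n)\<bar>
        \<le> (C * suminf g + 1) * real n powr (1/2)" if "n \<ge> N" for n :: nat
  proof -
    have n: "n > 0" using that assms(1) by simp
    let ?A = "{k::int. \<bar>k\<bar> \<le> int n - 1}"
    have term_le: "\<bar>1 / real n * F\<^sub>3 (real_of_int k / real n)\<bar>
        \<le> C * real n powr (1/2) * g (nat (int n - k))" if "k \<in> ?A" for k
    proof -
      define x where "x = real_of_int k / real n"
      define j where "j = nat (int n - k)"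
      have j: "real j = real n - real_of_int k" "j > 0"
        using that by (auto simp: j_def)
      have "x \<in> {-1..<1}"
        using that n by (auto simp: x_def field_simps)
      from C(2)[OF this] have "(1 - x) powr (3/2) * \<bar>F\<^sub>3 x\<bar> \<le> C"
        by (simp add: abs_mult)
      moreover have x: "1 - x = real j / real n"
        using n by (simp add: x_def j(1) field_simps)
      ultimately have "\<bar>F\<^sub>3 x\<bar> \<le> C / (real j / real n) powr (3/2)"
        using n j(2) by (simp add: pos_le_divide_eq mult.commute)
      also have "\<dots> = C * real n powr (3/2) * g j"
        using n j(2) by (simp add: powr_divide g_def powr_minus_divide)
      finally have "1 / real n * \<bar>F\<^sub>3 x\<bar> \<le> 1 / real n * (C * real n powr (3/2) * g j)"
        by (intro mult_left_mono) auto
      also have "real n powr (3/2) = real n * real n powr (1/2)"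
        using n powr_add[of "real n" 1 "1/2"] by simp
      finally show ?thesis
        using n by (simp add: abs_mult x_def j_def)
    qed
    have inj: "inj_on (\<lambda>k. nat (int n - k)) ?A"
      by (auto simp: inj_on_def)
    have fin: "finite ?A"
      by (rule finite_subset[of _ "{- int n..int n}"]) auto
    have "\<bar>\<Sum>k\<in>?A. 1 / real n * F\<^sub>3 (real_of_int k / real n)\<bar>
        \<le> (\<Sum>k\<in>?A. C * real n powr (1/2) * g (nat (int n - k)))"
      using term_le by (intro order.trans[OF sum_abs] sum_mono)
    also have "\<dots> = C * real n powr (1/2) * sum g ((\<lambda>k. nat (int n - k)) ` ?A)"
      by (simp only: sum.reindex[OF inj] sum_distrib_left o_def)
    also have "\<dots> \<le> C * real n powr (1/2) * suminf g"
      using C(1) fin g g_nonneg by (intro mult_left_mono sum_le_suminf) auto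
    also have "\<dots> \<le> (C * suminf g + 1) * real n powr (1/2)"
      by (simp add: algebra_simps)
    finally show ?thesis .
  qed
  moreover have "C * suminf g + 1 > 0"
    using C(1) suminf_nonneg[OF g g_nonneg] by (simp add: add_nonneg_pos)
  ultimately show ?thesis by blast
qed

end
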